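(* Let $n\ge 3$ and $p\ge\frac{n+2}{n-2}$. Let $\psi\in C^2([0,+\infty))$ be positive on $(0,+\infty)$ with $\psi(0)=\psi''(0)=0$, $\psi'(0)=1$ and $\psi'(r)\ge 0$ for every $r>0$. If $p=\frac{n+2}{n-2}$, assume furthermore that $\psi$ is three times differentiable near $0$ with $\psi''(0)=0$ and $\psi'''(0)>0$. Finally, let the function $$A(r):=\left(\int_0^r\psi(s)^{n-1}\,ds\right)^{\frac{p-1}{2(p+1)}}$$ be convex on $[0,+\infty)$. Then, for every $\alpha\ne 0$, the solution $u(r)$ of $$-\frac{1}{\psi(r)^{n-1}}\left[\psi(r)^{n-1}u'(r)\right]'=|u(r)|^{p-1}u(r)\quad(r>0),\qquad u(0)=\alpha,\quad u'(0)=0$$ does not change sign for all $r\in[0,+\infty)$. In particular, for every $0<\overline r<+\infty$, the Dirichlet problem $$-\Delta_g u=|u|^{p-1}u\ \text{ in } B_{\overline r},\qquad u=0\ \text{ on }\partial B_{\overline r}$$ has no nontrivial radial solutions.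
   Context: $(M,g)$ is the $n$-dimensional Riemannian model with pole $o$ and metric $ds^2=dr^2+\psi(r)^2d\Theta^2$ in polar coordinates $(r,\Theta)\in(0,\infty)\times\mathbb{S}^{n-1}$ around $o$ ($M$ is diffeomorphic to $\mathbb{R}^n$). $B_R$ is the geodesic ball of radius $R$ centered at $o$. A function is radial if it depends only on $r$, the distance from $o$; for radial $f$, $\Delta_g f=f''+(n-1)\frac{\psi'}{\psi}f'$. Up to a positive constant factor, $A(r)$ equals $[\mathrm{Vol}\,B_r]^{\frac{p-1}{2(p+1)}}$. *)

theory Defs
  imports "HOL-Analysis.Analysis"
begin

definition partial_deriv :: "'n \<Rightarrow> (real^'n \<Rightarrow> real) \<Rightarrow> real^'n \<Rightarrow> real"
  where "partial_deriv i f x = deriv (\<lambda>t. f (x + t *\<^sub>R axis i 1)) 0"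

definition C1_on :: "(real^'n) set \<Rightarrow> (real^'n \<Rightarrow> real) \<Rightarrow> bool"
  where "C1_on U f \<longleftrightarrow>
    (\<forall>x\<in>U. f differentiable (at x)) \<and> (\<forall>i. continuous_on U (partial_deriv i f))"

definition C2_on :: "(real^'n) set \<Rightarrow> (real^'n \<Rightarrow> real) \<Rightarrow> bool"
  where "C2_on U f \<longleftrightarrow> C1_on U f \<and> (\<forall>i. C1_on U (partial_deriv i f))"

text \<open>A Riemannian metric in a global chart is given by the field \<open>g\<close> of its
  coefficient matrices.\<close>

definition riem_grad :: "(real^'n \<Rightarrow> real^'n^'n) \<Rightarrow> (real^'n \<Rightarrow> real) \<Rightarrow> real^'n \<Rightarrow> real^'n"
  where "riem_grad g u x = matrix_inv (g x) *v (\<chi> i. partial_deriv i u x)"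

definition riem_div :: "(real^'n \<Rightarrow> real^'n^'n) \<Rightarrow> (real^'n \<Rightarrow> real^'n) \<Rightarrow> real^'n \<Rightarrow> real"
  where "riem_div g X x =
    (\<Sum>i\<in>UNIV. partial_deriv i (\<lambda>y. sqrt (det (g y)) * X y $ i) x) / sqrt (det (g x))"

definition laplace_beltrami ::
    "(real^'n \<Rightarrow> real^'n^'n) \<Rightarrow> (real^'n \<Rightarrow> real) \<Rightarrow> real^'n \<Rightarrow> real"
  where "laplace_beltrami g u = riem_div g (riem_grad g u)"

text \<open>The model manifold is identified with \<open>real^'n\<close> by sending the point with polar
  coordinates \<open>(r, \<Theta>)\<close> to \<open>r \<Theta>\<close> and the pole to \<open>0\<close>, so that \<open>norm x\<close> is the
  geodesic distance of \<open>x\<close> from the pole and \<open>ball 0 R\<close> is the geodesic ball of radius \<open>R\<close>.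
  In this chart \<open>dr = (x \<bullet> dx) / r\<close> and \<open>r\<^sup>2 d\<Theta>\<^sup>2 = \<bar>dx\<bar>\<^sup>2 - dr\<^sup>2\<close>, which gives the
  coefficients of \<open>dr\<^sup>2 + \<psi>(r)\<^sup>2 d\<Theta>\<^sup>2\<close> below. The value at \<open>0\<close> is the continuous extension,
  since \<open>\<psi>(0) = 0\<close> and \<open>\<psi>'(0) = 1\<close>.\<close>

definition model_metric :: "(real \<Rightarrow> real) \<Rightarrow> real^'n \<Rightarrow> real^'n^'n"
  where "model_metric \<psi> x =
    (if x = 0 then mat 1
     else (\<chi> i j. x $ i * x $ j / (norm x)\<^sup>2 +
       (\<psi> (norm x) / norm x)\<^sup>2 * ((if i = j then 1 else 0) - x $ i * x $ j / (norm x)\<^sup>2)))"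

definition radial_on :: "(real^'n) set \<Rightarrow> (real^'n \<Rightarrow> real) \<Rightarrow> bool"
  where "radial_on S u \<longleftrightarrow> (\<exists>f :: real \<Rightarrow> real. \<forall>x\<in>S. u x = f (norm x))"

text \<open>Classical solutions of the Dirichlet problem for the Lane-Emden equation.\<close>

definition dirichlet_solution ::
    "(real \<Rightarrow> real) \<Rightarrow> real \<Rightarrow> real \<Rightarrow> (real^'n \<Rightarrow> real) \<Rightarrow> bool"
  where "dirichlet_solution \<psi> p R u \<longleftrightarrow>
    C2_on (ball 0 R) u \<and> continuous_on (cball 0 R) u \<and>
    (\<forall>x\<in>ball 0 R.
       - laplace_beltrami (model_metric \<psi>) u x = \<bar>u x\<bar> powr (p - 1) * u x) \<and>
    (\<forall>x\<in>sphere 0 R. u x = 0)"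

definition ivp_solution ::
    "nat \<Rightarrow> (real \<Rightarrow> real) \<Rightarrow> real \<Rightarrow> real \<Rightarrow> (real \<Rightarrow> real) \<Rightarrow> bool"
  where "ivp_solution n \<psi> p \<alpha> u \<longleftrightarrow>
    (\<exists>u' w' :: real \<Rightarrow> real.
       (\<forall>r\<ge>0. (u has_real_derivative u' r) (at r within {0..})) \<and>
       (\<forall>r>0. ((\<lambda>s. \<psi> s ^ (n - 1) * u' s) has_real_derivative w' r) (at r)) \<and>
       (\<forall>r>0. - (1 / \<psi> r ^ (n - 1)) * w' r = \<bar>u r\<bar> powr (p - 1) * u r) \<and>
       u 0 = \<alpha> \<and> u' 0 = 0)"

definition changes_sign_on :: "real set \<Rightarrow> (real \<Rightarrow> real) \<Rightarrow> bool"
  where "changes_sign_on S u \<longleftrightarrow> (\<exists>r\<in>S. \<exists>s\<in>S. u r < 0 \<and> 0 < u s)"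

end

theory Submission
  imports Defs
begin

text \<open>
  Write \<open>w = \<psi> ^ (n - 1)\<close> for the density of the sphere of radius \<open>r\<close> and
  \<open>V r = integral {0..r} w\<close> for the volume of the ball, both up to the area of the unit sphere.
  Radial solutions satisfy \<open>(w u')' = - w \<bar>u\<bar>\<^sup>p\<^sup>-\<^sup>1 u\<close>. The theorem rests on the
  Pohozaev function

  \<open>P = V (u'\<^sup>2 / 2 + \<bar>u\<bar>\<^sup>p\<^sup>+\<^sup>1 / (p + 1)) + w u u' / (p + 1)\<close>,

  whose derivative along a solution is
  \<open>P' = u'\<^sup>2 / w * ((p + 3) / (2 (p + 1)) * w\<^sup>2 - V w')\<close>. With \<open>a = (p - 1) / (2 (p + 1))\<close> one has
  \<open>1 - a = (p + 3) / (2 (p + 1))\<close>, and the second derivative of \<open>V\<^sup>a\<close> is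
  \<open>a V\<^sup>a\<^sup>-\<^sup>2 (V w' - (1 - a) w\<^sup>2)\<close>. Convexity of \<open>A = V\<^sup>a\<close> is therefore exactly the
  growth condition that makes the bracket in \<open>P'\<close> nonpositive, and since \<open>P\<close> vanishes at the pole, \<open>P \<le> 0\<close> throughout
  (\<open>convex_powr_imp_growth\<close>, \<open>pohozaev_nonpos\<close>).

  Suppose a solution that is positive at the pole had a first zero \<open>R\<close>. The flux \<open>w u'\<close> starts
  from \<open>0\<close> and strictly decreases while \<open>u > 0\<close>, so it stays away from \<open>0\<close> near \<open>R\<close>.
  There \<open>P\<close> would approach \<open>V u'\<^sup>2 / 2 > 0\<close>, which contradicts \<open>P \<le> 0\<close>
  (\<open>positive_at_end\<close>). So a solution that is nonzero at the pole never vanishes.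

  In the Dirichlet problem the value at the pole could also be \<open>0\<close>. Then the energy
  \<open>u'\<^sup>2 / 2 + \<bar>u\<bar>\<^sup>p\<^sup>+\<^sup>1 / (p + 1)\<close> starts from \<open>0\<close> and, because \<open>\<psi>' \<ge> 0\<close>, cannot
  increase, so the solution is trivial (\<open>trivial_if_zero_at_pole\<close>). The link between the partial
  differential equation and the ordinary one is the formula for the Laplace-Beltrami operator on
  radial functions (\<open>laplace_beltrami_radial\<close>).
\<close>

section \<open>The radial Lane-Emden equation\<close>

lemma DERIV_abs_powr:
  fixes q x :: real
  assumes "1 < q"
  shows "((\<lambda>x. \<bar>x\<bar> powr q) has_real_derivative q * (\<bar>x\<bar> powr (q - 2) * x)) (at x)"
proof (cases x "0 :: real" rule: linorder_cases)
  case greater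
  have "((\<lambda>x. x powr q) has_real_derivative q * x powr (q - 1)) (at x)"
    using greater by (rule has_real_derivative_powr)
  moreover have "q * x powr (q - 1) = q * (\<bar>x\<bar> powr (q - 2) * x)"
    using greater powr_add[of x "q - 2" 1] by simp
  ultimately have "((\<lambda>x. x powr q) has_real_derivative q * (\<bar>x\<bar> powr (q - 2) * x)) (at x)"
    by simp
  then show ?thesis
    by (rule has_field_derivative_transform_within_open[where S = "{0<..}"]) (use greater in auto)
next
  case less
  have "((\<lambda>x. (- x) powr q) has_real_derivative q * (- x) powr (q - 1) * (- 1)) (at x)"
    by (rule DERIV_fun_powr derivative_eq_intros refl | use less in simp)+
  moreover have "q * (- x) powr (q - 1) * (- 1) = q * (\<bar>x\<bar> powr (q - 2) * x)"
    using less powr_add[of "- x" "q - 2" 1] by simp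
  ultimately have "((\<lambda>x. (- x) powr q) has_real_derivative q * (\<bar>x\<bar> powr (q - 2) * x)) (at x)"
    by simp
  then show ?thesis
    by (rule has_field_derivative_transform_within_open[where S = "{..<0}"]) (use less in auto)
next
  case equal
  have bound: "((\<lambda>h :: real. \<bar>h\<bar> powr (q - 1)) \<longlongrightarrow> 0) (at 0)"
    by (rule tendsto_zero_powrI[where b = "q - 1"])
      (use assms in \<open>auto intro!: tendsto_eq_intros\<close>)
  have "norm (\<bar>h\<bar> powr q / h) \<le> \<bar>h\<bar> powr (q - 1)" for h :: real
    using powr_add[of "\<bar>h\<bar>" "q - 1" 1] by (cases "h = 0") (auto simp: abs_mult)
  then have "((\<lambda>h :: real. \<bar>h\<bar> powr q / h) \<longlongrightarrow> 0) (at 0)"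
    by (intro Lim_null_comparison[OF _ bound]) auto
  with equal assms show ?thesis
    by (simp add: DERIV_def)
qed

text \<open>Solutions are not known to be \<open>C\<^sup>1\<close> at the pole, so limits there are only taken along a
  sequence. For a monotone function one sequence is enough.\<close>

lemma nonincreasing_le_limit_at_left_end:
  fixes f f' :: "real \<Rightarrow> real"
  assumes deriv: "\<And>r. 0 < r \<Longrightarrow> r < R \<Longrightarrow> (f has_real_derivative f' r) (at r)"
    and nonpos: "\<And>r. 0 < r \<Longrightarrow> r < R \<Longrightarrow> f' r \<le> 0"
    and \<xi>: "\<And>k. 0 < \<xi> k" "\<xi> \<longlonglongrightarrow> 0" and lim: "(\<lambda>k. f (\<xi> k)) \<longlonglongrightarrow> L"
    and r: "0 < r" "r < R"
  shows "f r \<le> L"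
proof (rule tendsto_lowerbound[OF lim])
  have "\<forall>\<^sub>F k in sequentially. \<xi> k < r"
    using \<xi>(2) r(1) by (rule order_tendstoD)
  then show "\<forall>\<^sub>F k in sequentially. f r \<le> f (\<xi> k)"
  proof eventually_elim
    case (elim k)
    show ?case
    proof (rule DERIV_nonpos_imp_nonincreasing[of "\<xi> k" r f])
      fix s assume "\<xi> k \<le> s" "s \<le> r"
      then show "\<exists>y. DERIV f s :> y \<and> y \<le> 0"
        using deriv nonpos \<xi>(1)[of k] r(2) by (intro exI[of _ "f' s"]) auto
    qed (use elim in auto)
  qed
qed simp

text \<open>The flux is required to be differentiable only away from the pole, and at the pole only the
  one-sided derivative of \<open>u\<close> is prescribed. This is what both the initial value problem and the
  profile of a solution on a ball provide. The Dirichlet profile need not be differentiable at \<open>R\<close>,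
  hence mere continuity there.\<close>

locale radial_lane_emden =
  fixes R p :: real and w w' u u' :: "real \<Rightarrow> real"
  assumes R_pos: "0 < R" and p_gt_1: "1 < p"
    and w_cont: "continuous_on {0..R} w"
    and w_pos: "\<And>r. 0 < r \<Longrightarrow> r < R \<Longrightarrow> 0 < w r"
    and w_deriv: "\<And>r. 0 < r \<Longrightarrow> r < R \<Longrightarrow> (w has_real_derivative w' r) (at r)"
    and u_cont: "continuous_on {0..R} u"
    and u_deriv_0: "(u has_real_derivative 0) (at_right 0)"
    and u_deriv: "\<And>r. 0 < r \<Longrightarrow> r < R \<Longrightarrow> (u has_real_derivative u' r) (at r)"
    and flux_deriv: "\<And>r. 0 < r \<Longrightarrow> r < R \<Longrightarrow>
      ((\<lambda>s. w s * u' s) has_real_derivative - (w r * (\<bar>u r\<bar> powr (p - 1) * u r))) (at r)"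
begin

lemma shorten:
  assumes "0 < S" "S \<le> R"
  shows "radial_lane_emden S p w w' u u'"
  using assms p_gt_1 w_pos w_deriv u_deriv_0 u_deriv flux_deriv
    continuous_on_subset[OF w_cont, of "{0..S}"] continuous_on_subset[OF u_cont, of "{0..S}"]
  by unfold_locales auto

lemma negate: "radial_lane_emden R p w w' (\<lambda>r. - u r) (\<lambda>r. - u' r)"
proof
  show "((\<lambda>r. - u r) has_real_derivative 0) (at_right 0)"
    using DERIV_minus[OF u_deriv_0] by simp
  fix r assume "0 < r" "r < R"
  then show "((\<lambda>s. w s * - u' s) has_real_derivative
      - (w r * (\<bar>- u r\<bar> powr (p - 1) * - u r))) (at r)"
    using DERIV_minus[OF flux_deriv] by simp
qed (use R_pos p_gt_1 w_cont w_pos w_deriv u_cont u_deriv in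
    \<open>auto intro!: derivative_intros continuous_intros\<close>)

lemma u'_deriv:
  assumes r: "0 < r" "r < R"
  shows "(u' has_real_derivative - (\<bar>u r\<bar> powr (p - 1) * u r) - w' r / w r * u' r) (at r)"
proof -
  have "((\<lambda>s. w s * u' s / w s) has_real_derivative
      - (\<bar>u r\<bar> powr (p - 1) * u r) - w' r / w r * u' r) (at r)"
    by (rule derivative_eq_intros flux_deriv w_deriv r refl)+
      (use w_pos[OF r] in \<open>auto simp: field_simps\<close>)
  then show ?thesis
    by (rule has_field_derivative_transform_within_open[where S = "{0<..<R}"])
      (use r w_pos[THEN less_imp_neq] in auto)
qed

text \<open>The difference quotients \<open>(u h - u 0) / h\<close> tend to \<open>0\<close>, and each of them is a value of
  \<open>u'\<close> by the mean value theorem. This replaces continuity of \<open>u'\<close> at the pole.\<close>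

lemma slope_vanishing_sequence:
  obtains \<xi> :: "nat \<Rightarrow> real"
  where "\<And>k. 0 < \<xi> k" "\<And>k. \<xi> k < R" "\<xi> \<longlonglongrightarrow> 0" "(\<lambda>k. u' (\<xi> k)) \<longlonglongrightarrow> 0"
proof -
  define h where "h k = R / real (k + 2)" for k
  have h: "0 < h k" "h k < R" for k
    using R_pos by (auto simp: h_def divide_simps)
  have h_lim: "h \<longlonglongrightarrow> 0"
    unfolding h_def by (rule LIMSEQ_ignore_initial_segment) (rule lim_const_over_n)
  have "\<exists>\<xi>. 0 < \<xi> \<and> \<xi> < h k \<and> u' \<xi> = (u (h k) - u 0) / h k" for k
  proof -
    have "\<exists>l z. 0 < z \<and> z < h k \<and> DERIV u z :> l \<and> u (h k) - u 0 = (h k - 0) * l"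
    proof (rule MVT)
      show "continuous_on {0..h k} u"
        using continuous_on_subset[OF u_cont] h[of k] by auto
      show "u differentiable at x" if "0 < x" "x < h k" for x
        using u_deriv[of x] that h[of k] real_differentiable_def by force
    qed (use h in auto)
    then obtain l z where z: "0 < z" "z < h k" "DERIV u z :> l" "u (h k) - u 0 = h k * l"
      by auto
    then have "l = u' z"
      using u_deriv[of z] h[of k] DERIV_unique by fastforce
    with z h[of k] show ?thesis by (intro exI[of _ z]) auto
  qed
  then obtain \<xi> where \<xi>: "\<And>k. 0 < \<xi> k" "\<And>k. \<xi> k < h k"
    and slope: "\<And>k. u' (\<xi> k) = (u (h k) - u 0) / h k"
    by metis
  have "\<xi> \<longlonglongrightarrow> 0"
    by (rule tendsto_sandwich[OF _ _ tendsto_const h_lim])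
      (use \<xi> in \<open>auto intro!: always_eventually less_imp_le\<close>)
  moreover have "(\<lambda>k. u' (\<xi> k)) \<longlonglongrightarrow> 0"
  proof -
    have "((\<lambda>y. (u y - u 0) / (y - 0)) \<longlongrightarrow> 0) (at_right 0)"
      using u_deriv_0 by (simp add: has_field_derivative_iff)
    moreover have "filterlim h (at_right 0) sequentially"
      using h h_lim less_imp_neq[OF h(1)] by (simp add: filterlim_at)
    ultimately show ?thesis
      unfolding slope by (auto dest: filterlim_compose)
  qed
  moreover have "\<xi> k < R" for k
    using \<xi>(2)[of k] h(2)[of k] by simp
  ultimately show ?thesis
    using that \<xi>(1) by blast
qed

lemma tendsto_along:
  assumes "\<And>k :: nat. 0 < \<xi> k" "\<And>k. \<xi> k < R" "\<xi> \<longlonglongrightarrow> 0"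
  shows "(\<lambda>k. u (\<xi> k)) \<longlonglongrightarrow> u 0" and "(\<lambda>k. w (\<xi> k)) \<longlonglongrightarrow> w 0"
    and "(\<lambda>k. \<bar>u (\<xi> k)\<bar> powr (p + 1) / (p + 1)) \<longlonglongrightarrow> \<bar>u 0\<bar> powr (p + 1) / (p + 1)"
proof -
  have in_dom: "\<forall>\<^sub>F k in sequentially. \<xi> k \<in> {0..R}"
    using assms less_imp_le by (intro always_eventually) auto
  show u: "(\<lambda>k. u (\<xi> k)) \<longlonglongrightarrow> u 0"
    by (rule continuous_on_tendsto_compose[OF u_cont assms(3) _ in_dom]) (use R_pos in simp)
  show "(\<lambda>k. w (\<xi> k)) \<longlonglongrightarrow> w 0"
    by (rule continuous_on_tendsto_compose[OF w_cont assms(3) _ in_dom]) (use R_pos in simp)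
  have "isCont (\<lambda>x. \<bar>x\<bar> powr (p + 1)) (u 0)"
    using DERIV_abs_powr[of "p + 1"] p_gt_1 DERIV_isCont by force
  then show "(\<lambda>k. \<bar>u (\<xi> k)\<bar> powr (p + 1) / (p + 1)) \<longlonglongrightarrow> \<bar>u 0\<bar> powr (p + 1) / (p + 1)"
    using p_gt_1 by (intro tendsto_divide tendsto_const isCont_tendsto_compose[OF _ u]) auto
qed

lemma potential_deriv:
  assumes "0 < r" "r < R"
  shows "((\<lambda>s. \<bar>u s\<bar> powr (p + 1) / (p + 1)) has_real_derivative
    \<bar>u r\<bar> powr (p - 1) * u r * u' r) (at r)"
proof -
  have "((\<lambda>s. \<bar>u s\<bar> powr (p + 1)) has_real_derivative
      (p + 1) * (\<bar>u r\<bar> powr (p + 1 - 2) * u r) * u' r) (at r)"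
    using p_gt_1 by (intro DERIV_chain2[OF DERIV_abs_powr u_deriv] assms) auto
  from DERIV_cdivide[OF this, of "p + 1"] show ?thesis
    using p_gt_1 by (simp add: mult.assoc)
qed

text \<open>Along the equation \<open>u'' + (w' / w) u' + \<bar>u\<bar>\<^sup>p\<^sup>-\<^sup>1 u = 0\<close> the first-order term acts as
  friction: it is the only contribution to the change of the energy.\<close>

lemma energy_deriv:
  assumes r: "0 < r" "r < R"
  shows "((\<lambda>s. (u' s)\<^sup>2 / 2 + \<bar>u s\<bar> powr (p + 1) / (p + 1)) has_real_derivative
    - (w' r / w r * (u' r)\<^sup>2)) (at r)"
proof -
  have "((\<lambda>s. (u' s)\<^sup>2 / 2) has_real_derivative
      u' r * (- (\<bar>u r\<bar> powr (p - 1) * u r) - w' r / w r * u' r)) (at r)"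
    using DERIV_cdivide[OF DERIV_mult[OF u'_deriv u'_deriv, OF r r], of 2]
    by (simp add: power2_eq_square mult.commute)
  from DERIV_add[OF this potential_deriv[OF r]] show ?thesis
    by (simp add: algebra_simps power2_eq_square)
qed

text \<open>Uniqueness for zero data at the singular point: with nonnegative friction the energy, a sum of
  two nonnegative terms, cannot rise above its limit \<open>0\<close> at the pole.\<close>

lemma trivial_if_zero_at_pole:
  assumes w'_nonneg: "\<And>r. 0 < r \<Longrightarrow> r < R \<Longrightarrow> 0 \<le> w' r"
    and u0: "u 0 = 0" and r: "0 \<le> r" "r < R"
  shows "u r = 0"
proof (cases "r = 0")
  case False
  with r have r: "0 < r" "r < R" by auto
  define E where "E s = (u' s)\<^sup>2 / 2 + \<bar>u s\<bar> powr (p + 1) / (p + 1)" for s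
  obtain \<xi> where \<xi>: "\<And>k. 0 < \<xi> k" "\<And>k. \<xi> k < R" "\<xi> \<longlonglongrightarrow> 0" "(\<lambda>k. u' (\<xi> k)) \<longlonglongrightarrow> 0"
    using slope_vanishing_sequence by blast
  have "E r \<le> 0"
  proof (rule nonincreasing_le_limit_at_left_end[OF _ _ \<xi>(1,3) _ r])
    show "(E has_real_derivative - (w' s / w s * (u' s)\<^sup>2)) (at s)" if "0 < s" "s < R" for s
      unfolding E_def using that by (rule energy_deriv)
    show "- (w' s / w s * (u' s)\<^sup>2) \<le> 0" if "0 < s" "s < R" for s
      using w_pos[of s] w'_nonneg[of s] that by simp
    show "(\<lambda>k. E (\<xi> k)) \<longlonglongrightarrow> 0"
      unfolding E_def
      using tendsto_add[OF tendsto_divide[OF tendsto_power[OF \<xi>(4), of 2] tendsto_const[of 2]]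
          tendsto_along(3)[OF \<xi>(1-3)]] u0 p_gt_1 by simp
  qed
  moreover have "0 \<le> (u' r)\<^sup>2 / 2" "0 \<le> \<bar>u r\<bar> powr (p + 1) / (p + 1)"
    using p_gt_1 by auto
  ultimately have "\<bar>u r\<bar> powr (p + 1) / (p + 1) = 0"
    unfolding E_def by linarith
  with p_gt_1 show ?thesis by simp
qed (use u0 in simp)

text \<open>The equation makes the flux strictly decreasing while \<open>u\<close> is positive, and its limit along the
  sequence with vanishing slopes is \<open>0\<close>.\<close>

lemma flux_neg:
  assumes u_pos: "\<And>r. 0 < r \<Longrightarrow> r < R \<Longrightarrow> 0 < u r" and r: "0 < r" "r < R"
  shows "w r * u' r < 0" 
    and "r \<le> s \<Longrightarrow> s < R \<Longrightarrow> w s * u' s \<le> w r * u' r"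
proof -
  have slope: "- (w s * (\<bar>u s\<bar> powr (p - 1) * u s)) < 0" if "0 < s" "s < R" for s
    using u_pos[OF that] w_pos[OF that] by simp
  obtain \<xi> where \<xi>: "\<And>k. 0 < \<xi> k" "\<And>k. \<xi> k < R" "\<xi> \<longlonglongrightarrow> 0" "(\<lambda>k. u' (\<xi> k)) \<longlonglongrightarrow> 0"
    using slope_vanishing_sequence by blast
  have "(\<lambda>k. w (\<xi> k) * u' (\<xi> k)) \<longlonglongrightarrow> 0"
    using tendsto_mult[OF tendsto_along(2)[OF \<xi>(1-3)] \<xi>(4)] by simp
  with r have "w (r/2) * u' (r/2) \<le> 0"
    by (intro nonincreasing_le_limit_at_left_end[OF flux_deriv _ \<xi>(1,3)] less_imp_le slope) auto
  moreover have "w r * u' r < w (r/2) * u' (r/2)"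
  proof (rule DERIV_neg_imp_decreasing[of "r/2" r "\<lambda>s. w s * u' s"])
    fix s assume "r / 2 \<le> s" "s \<le> r"
    then have "0 < s" "s < R" using r by auto
    then show "\<exists>y. ((\<lambda>s. w s * u' s) has_real_derivative y) (at s) \<and> y < 0"
      using flux_deriv slope by blast
  qed (use r in simp)
  ultimately show "w r * u' r < 0" by simp
  assume "r \<le> s" "s < R"
  then show "w s * u' s \<le> w r * u' r"
  proof (intro DERIV_nonpos_imp_nonincreasing[of r s "\<lambda>s. w s * u' s"])
    fix t assume "r \<le> t" "t \<le> s"
    then have "0 < t" "t < R" using r \<open>s < R\<close> by auto
    then show "\<exists>y. ((\<lambda>s. w s * u' s) has_real_derivative y) (at t) \<and> y \<le> 0"
      using flux_deriv slope less_imp_le by blast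
  qed
qed

text \<open>The weight \<open>1 / (p + 1)\<close> of the term \<open>w u u'\<close> is the one for which all terms with
  \<open>\<bar>u\<bar>\<^sup>p\<^sup>+\<^sup>1\<close> cancel in the derivative of the Pohozaev function. What remains is a multiple of
  \<open>u'\<^sup>2\<close> whose sign is given by the growth condition on the volume.\<close>

lemma pohozaev_nonpos:
  assumes V_deriv: "\<And>r. 0 < r \<Longrightarrow> r < R \<Longrightarrow> (V has_real_derivative w r) (at r)"
    and V_0: "(V \<longlongrightarrow> 0) (at_right 0)"
    and growth: "\<And>r. 0 < r \<Longrightarrow> r < R \<Longrightarrow> (p + 3) / (2 * (p + 1)) * (w r)\<^sup>2 \<le> V r * w' r"
    and r: "0 < r" "r < R"
  shows "V r * ((u' r)\<^sup>2 / 2 + \<bar>u r\<bar> powr (p + 1) / (p + 1)) + w r * u' r * u r / (p + 1) \<le> 0"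
proof -
  define P where "P s = V s * ((u' s)\<^sup>2 / 2 + \<bar>u s\<bar> powr (p + 1) / (p + 1))
    + w s * u' s * u s / (p + 1)" for s
  define P' where "P' s = (u' s)\<^sup>2 / w s * ((p + 3) / (2 * (p + 1)) * (w s)\<^sup>2 - V s * w' s)" for s
  obtain \<xi> where \<xi>: "\<And>k. 0 < \<xi> k" "\<And>k. \<xi> k < R" "\<xi> \<longlonglongrightarrow> 0" "(\<lambda>k. u' (\<xi> k)) \<longlonglongrightarrow> 0"
    using slope_vanishing_sequence by blast
  note lim = tendsto_along[OF \<xi>(1-3)]
  have "P r \<le> 0"
  proof (rule nonincreasing_le_limit_at_left_end[OF _ _ \<xi>(1,3) _ r])
    fix s assume s: "0 < s" "s < R"
    note w = w_pos[OF s]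
    define N where "N = \<bar>u s\<bar> powr (p - 1) * u s"
    have pot: "\<bar>u s\<bar> powr (p + 1) = N * u s"
      using powr_add[of "\<bar>u s\<bar>" "p - 1" 2] p_gt_1
      by (cases "u s = 0") (simp_all add: N_def power2_eq_square add.commute mult.assoc)
    \<comment> \<open>the energy identity eliminates \<open>u''\<close>, and \<open>pot\<close> lets the terms in \<open>N u\<close> cancel\<close>
    have "(P has_real_derivative
        w s * ((u' s)\<^sup>2 / 2 + N * u s / (p + 1)) - w' s / w s * (u' s)\<^sup>2 * V s
        + (- (w s * N) * u s + u' s * (w s * u' s)) / (p + 1)) (at s)"
      using DERIV_add[OF DERIV_mult[OF V_deriv energy_deriv]
          DERIV_cdivide[OF DERIV_mult[OF flux_deriv u_deriv], of _ "p + 1"], OF s s s s]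
      unfolding P_def pot N_def[symmetric] by simp
    also have "w s * ((u' s)\<^sup>2 / 2 + N * u s / (p + 1)) - w' s / w s * (u' s)\<^sup>2 * V s
        + (- (w s * N) * u s + u' s * (w s * u' s)) / (p + 1) = P' s"
    proof -
      have coeff: "(p + 3) / (2 * (p + 1)) = 1 / 2 + 1 / (p + 1)"
        using p_gt_1 by (simp add: field_simps)
      show ?thesis
        unfolding P'_def coeff using w
        by (simp add: algebra_simps power2_eq_square add_divide_distrib diff_divide_distrib)
    qed
    finally show "(P has_real_derivative P' s) (at s)" .
    show "P' s \<le> 0"
      unfolding P'_def using w growth[OF s] by (intro mult_nonneg_nonpos) auto
  next
    have "filterlim \<xi> (at_right 0) sequentially"
      using \<xi> less_imp_neq[OF \<xi>(1)] by (simp add: filterlim_at)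
    then have "(\<lambda>k. V (\<xi> k)) \<longlonglongrightarrow> 0"
      using V_0 filterlim_compose by blast
    then show "(\<lambda>k. P (\<xi> k)) \<longlonglongrightarrow> 0"
      unfolding P_def using p_gt_1 by (auto intro!: tendsto_eq_intros lim \<xi>(4))
  qed
  then show ?thesis by (simp add: P_def)
qed

text \<open>With \<open>z = - w u' > 0\<close>, dropping the potential term from \<open>P \<le> 0\<close> and dividing by \<open>z\<close>
  gives \<open>V z / (2 w\<^sup>2) \<le> u / (p + 1)\<close>. On the outer half of the interval \<open>V\<close> and \<open>z\<close> are
  at least their values at \<open>R / 2\<close> and \<open>w\<close> is bounded, which keeps \<open>u\<close> above a positive
  constant up to \<open>R\<close>.\<close>

lemma positive_at_end:
  assumes V_deriv: "\<And>r. 0 < r \<Longrightarrow> r < R \<Longrightarrow> (V has_real_derivative w r) (at r)"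
    and V_0: "(V \<longlongrightarrow> 0) (at_right 0)"
    and V_pos: "\<And>r. 0 < r \<Longrightarrow> r < R \<Longrightarrow> 0 < V r"
    and growth: "\<And>r. 0 < r \<Longrightarrow> r < R \<Longrightarrow> (p + 3) / (2 * (p + 1)) * (w r)\<^sup>2 \<le> V r * w' r"
    and u_pos: "\<And>r. 0 < r \<Longrightarrow> r < R \<Longrightarrow> 0 < u r"
  shows "0 < u R"
proof -
  define a where "a = R / 2"
  have a: "0 < a" "a < R" using R_pos by (auto simp: a_def)
  define c where "c = - (w a * u' a)"
  have c: "0 < c" unfolding c_def using flux_neg(1)[OF u_pos a] by simp
  obtain W where W: "0 < W" "\<And>r. r \<in> {0..R} \<Longrightarrow> norm (w r) \<le> W"
    using compact_imp_bounded[OF compact_continuous_image[OF w_cont compact_Icc]]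
    unfolding bounded_pos by auto
  define d where "d = (p + 1) * (V a * c / (2 * W\<^sup>2))"
  have d: "0 < d" unfolding d_def using a V_pos c W(1) p_gt_1 by simp
  have lower: "d \<le> u s" if s: "a \<le> s" "s < R" for s
  proof -
    have s': "0 < s" "s < R" using s a by auto
    define z where "z = - (w s * u' s)"
    have z: "c \<le> z" "0 < z"
      using flux_neg(2)[OF u_pos a s] c by (auto simp: z_def c_def)
    have V: "V a \<le> V s"
      by (rule DERIV_nonneg_imp_nondecreasing[OF s(1)])
        (use V_deriv w_pos a s in \<open>meson less_imp_le less_le_trans le_less_trans\<close>)
    have w: "0 < w s" "w s \<le> W" using w_pos[OF s'] W(2)[of s] s' by auto
    have u': "u' s = - z / w s" using w by (simp add: z_def)
    have "V s * (z\<^sup>2 / (2 * (w s)\<^sup>2)) = V s * ((u' s)\<^sup>2 / 2)"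
      using w by (simp add: u' power_divide)
    also have "\<dots> \<le> V s * ((u' s)\<^sup>2 / 2 + \<bar>u s\<bar> powr (p + 1) / (p + 1))"
      using V_pos[OF s'] p_gt_1 by (intro mult_left_mono) auto
    also have "\<dots> \<le> z * u s / (p + 1)"
      using pohozaev_nonpos[OF V_deriv V_0 growth s'] by (simp add: z_def)
    finally have "z * (V s * z / (2 * (w s)\<^sup>2)) \<le> z * (u s / (p + 1))"
      by (simp add: power2_eq_square mult_ac)
    then have "V s * z / (2 * (w s)\<^sup>2) \<le> u s / (p + 1)"
      using z(2) mult_le_cancel_left_pos by blast
    moreover have "V a * c / (2 * W\<^sup>2) \<le> V s * z / (2 * (w s)\<^sup>2)"
      using V z w c V_pos[OF a] V_pos[OF s'] W(1)
      by (intro frac_le mult_mono mult_left_mono power_mono) auto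
    ultimately have "V a * c / (2 * W\<^sup>2) \<le> u s / (p + 1)" by linarith
    then show ?thesis
      using p_gt_1 by (simp add: d_def field_simps)
  qed
  have "(u \<longlongrightarrow> u R) (at_left R)"
    using u_cont R_pos by (simp add: continuous_on_Icc_at_leftD)
  moreover have "\<forall>\<^sub>F s in at_left R. d \<le> u s"
    using eventually_at_left_real[OF a(2)] by eventually_elim (auto intro: lower)
  ultimately have "d \<le> u R"
    by (rule tendsto_lowerbound) simp
  with d show ?thesis by simp
qed

lemma no_zero_if_pos:
  assumes V_deriv: "\<And>r. 0 < r \<Longrightarrow> r < R \<Longrightarrow> (V has_real_derivative w r) (at r)"
    and V_0: "(V \<longlongrightarrow> 0) (at_right 0)"
    and V_pos: "\<And>r. 0 < r \<Longrightarrow> r < R \<Longrightarrow> 0 < V r"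
    and growth: "\<And>r. 0 < r \<Longrightarrow> r < R \<Longrightarrow> (p + 3) / (2 * (p + 1)) * (w r)\<^sup>2 \<le> V r * w' r"
    and u0: "0 < u 0"
  shows "u R \<noteq> 0"
proof
  assume "u R = 0"
  \<comment> \<open>\<open>S\<close> is the first zero, so that \<open>positive_at_end\<close> applies on \<open>{0..S}\<close>\<close>
  define Z where "Z = {0..R} \<inter> u -` {0}"
  have "compact Z"
    unfolding Z_def
    by (simp add: compact_eq_bounded_closed bounded_Int continuous_closed_preimage u_cont)
  moreover have "R \<in> Z" using \<open>u R = 0\<close> R_pos by (simp add: Z_def)
  ultimately obtain S where S: "S \<in> Z" "\<And>t. t \<in> Z \<Longrightarrow> S \<le> t"
    using compact_attains_inf[of Z] by blast
  have S': "0 < S" "S \<le> R" "u S = 0"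
    using S(1) u0 by (auto simp: Z_def less_le)
  interpret short: radial_lane_emden S p w w' u u'
    by (rule shorten) (use S' in auto)
  have pos: "0 < u r" if r: "0 < r" "r < S" for r
  proof (rule ccontr)
    assume "\<not> 0 < u r"
    then have "\<exists>x\<ge>0. x \<le> r \<and> u x = 0"
      using r S' u0 by (intro IVT2') (auto intro: continuous_on_subset[OF u_cont])
    then obtain x where "x \<in> Z" "x < S"
      using r S' by (auto simp: Z_def)
    with S(2) show False by force
  qed
  have "0 < u S"
    by (rule short.positive_at_end[OF V_deriv V_0 V_pos growth pos]) (use S' in auto)
  with S' show False by simp
qed

lemma no_zero:
  assumes "\<And>r. 0 < r \<Longrightarrow> r < R \<Longrightarrow> (V has_real_derivative w r) (at r)"
    and "(V \<longlongrightarrow> 0) (at_right 0)"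
    and "\<And>r. 0 < r \<Longrightarrow> r < R \<Longrightarrow> 0 < V r"
    and "\<And>r. 0 < r \<Longrightarrow> r < R \<Longrightarrow> (p + 3) / (2 * (p + 1)) * (w r)\<^sup>2 \<le> V r * w' r"
    and "u 0 \<noteq> 0"
  shows "u R \<noteq> 0"
proof (cases "0 < u 0")
  case True
  with assms show ?thesis by (intro no_zero_if_pos)
next
  case False
  interpret neg: radial_lane_emden R p w w' "\<lambda>r. - u r" "\<lambda>r. - u' r"
    by (rule negate)
  have "- u R \<noteq> 0"
    using False assms by (intro neg.no_zero_if_pos[of V]) auto
  then show ?thesis by simp
qed

end

section \<open>Convexity of a power of the volume\<close>

text \<open>The conclusion is the inequality \<open>(V\<^sup>a)'' \<ge> 0\<close> freed from the positive factor
  \<open>a V\<^sup>a\<^sup>-\<^sup>2\<close>. Comparing the tangents at two points shows that the derivative of a convex function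
  is monotone, and so its own derivative is nonnegative.\<close>

lemma convex_powr_imp_growth:
  fixes V w w' :: "real \<Rightarrow> real"
  assumes convex: "convex_on {0<..} (\<lambda>r. V r powr a)" and a: "0 < a"
    and V_deriv: "\<And>r. 0 < r \<Longrightarrow> (V has_real_derivative w r) (at r)"
    and V_pos: "\<And>r. 0 < r \<Longrightarrow> 0 < V r"
    and w_deriv: "\<And>r. 0 < r \<Longrightarrow> (w has_real_derivative w' r) (at r)"
    and r: "0 < r"
  shows "(1 - a) * (w r)\<^sup>2 \<le> V r * w' r"
proof -
  define A' where "A' s = a * V s powr (a - 1) * w s" for s
  have A_deriv: "((\<lambda>s. V s powr a) has_real_derivative A' s) (at s)" if "0 < s" for s
    unfolding A'_def using DERIV_fun_powr[OF V_deriv V_pos, OF that that, of a] by simp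
  have "mono_on {0<..} A'"
  proof (rule mono_onI)
    fix s t :: real assume st: "s \<in> {0<..}" "t \<in> {0<..}" "s \<le> t"
    \<comment> \<open>taken at \<open>s\<close> and at \<open>t\<close>; adding the two inequalities compares the slopes\<close>
    have tangent: "V y powr a - V x powr a \<ge> A' x * (y - x)" if "0 < x" "0 < y" for x y
      using that by (intro convex_on_imp_above_tangent[OF convex])
        (auto intro: has_field_derivative_at_within A_deriv simp: interior_open)
    have "(A' t - A' s) * (t - s) \<ge> 0"
      using tangent[of s t] tangent[of t s] st by (auto simp: algebra_simps)
    then show "A' s \<le> A' t"
      using st by (cases "s = t") (auto simp: zero_le_mult_iff)
  qed
  moreover have "(A' has_real_derivative
      a * V r powr (a - 2) * (V r * w' r - (1 - a) * (w r)\<^sup>2)) (at r)"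
  proof -
    have "V r powr (a - 1) = V r powr (a - 2) * V r"
      using V_pos[OF r] powr_add[of "V r" "a - 2" 1] by simp
    moreover have "((\<lambda>s. V s powr (a - 1)) has_real_derivative
        (a - 1) * V r powr (a - 2) * w r) (at r)"
      using DERIV_fun_powr[OF V_deriv V_pos, OF r r, of "a - 1"] by simp
    note DERIV_mult[OF DERIV_cmult[OF this, of a] w_deriv[OF r]]
    ultimately show ?thesis
      unfolding A'_def by (elim DERIV_cong) (simp add: algebra_simps power2_eq_square)
  qed
  ultimately have "0 \<le> a * V r powr (a - 2) * (V r * w' r - (1 - a) * (w r)\<^sup>2)"
    by (rule mono_on_imp_deriv_nonneg) (use r in \<open>simp add: interior_open\<close>)
  moreover have "0 < a * V r powr (a - 2)"
    using a V_pos[OF r] by simp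
  ultimately show ?thesis
    by (simp add: zero_le_mult_iff)
qed

section \<open>The Laplace-Beltrami operator of the model metric on radial functions\<close>

lemma has_derivative_along_axis:
  assumes "(f has_derivative D) (at (x + s *\<^sub>R axis i 1))"
  shows "((\<lambda>t. f (x + t *\<^sub>R axis i 1)) has_real_derivative D (axis i 1)) (at s)"
proof -
  have "((\<lambda>t. f (x + t *\<^sub>R axis i 1)) has_derivative (\<lambda>t. D (t *\<^sub>R axis i 1))) (at s)"
    by (rule has_derivative_compose[where f = "\<lambda>t. x + t *\<^sub>R axis i 1" and g = f, OF _ assms]) (auto intro!: derivative_eq_intros)
  then show ?thesis
    using linear_scale[OF has_derivative_linear[OF assms]]
    by (simp add: has_field_derivative_def mult.commute[of _ "D (axis i 1)"])
qed

lemma partial_deriv_has_derivative: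
  assumes "(f has_derivative D) (at x)"
  shows "partial_deriv i f x = D (axis i 1)"
  unfolding partial_deriv_def
  by (rule DERIV_imp_deriv) (use assms in \<open>simp add: has_derivative_along_axis\<close>)

lemma partial_deriv_cong:
  assumes "open S" "x \<in> S" "\<And>y. y \<in> S \<Longrightarrow> f y = g y"
  shows "partial_deriv i f x = partial_deriv i g x"
  unfolding partial_deriv_def
proof (rule deriv_cong_ev[OF _ refl])
  have "((\<lambda>t. x + t *\<^sub>R axis i 1) \<longlongrightarrow> x) (nhds 0)"
    by (auto intro!: tendsto_eq_intros filterlim_ident)
  then have "\<forall>\<^sub>F t in nhds 0. x + t *\<^sub>R axis i 1 \<in> S"
    using assms(1,2) by (auto dest: topological_tendstoD)
  then show "\<forall>\<^sub>F t in nhds 0. f (x + t *\<^sub>R axis i 1) = g (x + t *\<^sub>R axis i 1)"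
    by eventually_elim (rule assms(3))
qed

lemma radial_has_derivative:
  assumes "x \<noteq> 0" and "(h has_real_derivative h') (at (norm x))"
  shows "((\<lambda>y. h (norm y)) has_derivative (\<lambda>v. h' * (v \<bullet> sgn x))) (at x)"
  using has_derivative_compose[OF has_derivative_norm[OF assms(1)]]
    assms(2)[unfolded has_field_derivative_def] by blast

text \<open>The divergence of the field \<open>h(\<bar>y\<bar>) y\<close>: the partial derivatives are
  \<open>h' \<bar>x\<bar> (x\<^sub>i / \<bar>x\<bar>)\<^sup>2 + h\<close>, and the squared components of the unit vector \<open>x / \<bar>x\<bar>\<close>
  add up to \<open>1\<close>.\<close>

lemma partial_deriv_radial_field:
  fixes x :: "real^'n"
  assumes x: "x \<noteq> 0" and h: "(h has_real_derivative h') (at (norm x))"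
  shows "(\<Sum>i\<in>UNIV. partial_deriv i (\<lambda>y. h (norm y) * y $ i) x) =
    h' * norm x + real CARD('n) * h (norm x)"
proof -
  have "partial_deriv i (\<lambda>y. h (norm y) * y $ i) x = h' * norm x * (sgn x $ i)\<^sup>2 + h (norm x)" for i
  proof -
    have "((\<lambda>y. h (norm y) * y $ i) has_derivative
        (\<lambda>v. h (norm x) * v $ i + h' * (v \<bullet> sgn x) * x $ i)) (at x)"
      by (rule has_derivative_mult radial_has_derivative x h bounded_linear.has_derivative
        bounded_linear_vec_nth has_derivative_ident)+
    from partial_deriv_has_derivative[OF this, of i] x show ?thesis
      by (simp add: inner_axis' sgn_div_norm power2_eq_square)
  qed
  then have "(\<Sum>i\<in>UNIV. partial_deriv i (\<lambda>y. h (norm y) * y $ i) x) =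
      h' * norm x * (sgn x \<bullet> sgn x) + real CARD('n) * h (norm x)"
    by (simp add: sum.distrib sum_distrib_left[symmetric] inner_vec_def power2_eq_square)
  also have "sgn x \<bullet> sgn x = 1"
    using x by (simp add: norm_sgn dot_square_norm)
  finally show ?thesis by simp
qed

text \<open>As a linear map the coefficient matrix is the identity in the radial direction and
  multiplication by \<open>(\<psi>(r) / r)\<^sup>2\<close> orthogonally to it.\<close>

lemma model_metric_mult:
  fixes x v :: "real^'n"
  assumes "x \<noteq> 0"
  shows "model_metric \<psi> x *v v = (sgn x \<bullet> v) *\<^sub>R sgn x +
    (\<psi> (norm x) / norm x)\<^sup>2 *\<^sub>R (v - (sgn x \<bullet> v) *\<^sub>R sgn x)"
proof -
  define q where "q = (\<psi> (norm x) / norm x)\<^sup>2"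
  have "(model_metric \<psi> x *v v) $ i =
      ((sgn x \<bullet> v) *\<^sub>R sgn x + q *\<^sub>R (v - (sgn x \<bullet> v) *\<^sub>R sgn x)) $ i" for i
  proof -
    have entry: "model_metric \<psi> x $ i $ j =
        (1 - q) * sgn x $ i * sgn x $ j + q * (if i = j then 1 else 0)" for j
      using assms unfolding model_metric_def q_def[symmetric]
      by (simp add: sgn_div_norm power2_eq_square divide_simps) (simp add: algebra_simps)
    have "(model_metric \<psi> x *v v) $ i =
        (\<Sum>j\<in>UNIV. (1 - q) * sgn x $ i * (sgn x $ j * v $ j) + (if i = j then q * v $ j else 0))"
      unfolding matrix_vector_mult_def by (auto simp: entry algebra_simps intro!: sum.cong)
    also have "\<dots> = (1 - q) * sgn x $ i * (sgn x \<bullet> v) + q * v $ i"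
      by (simp add: sum.distrib sum_distrib_left[symmetric] inner_vec_def)
    finally show ?thesis by (simp add: algebra_simps)
  qed
  then show ?thesis by (simp add: vec_eq_iff q_def)
qed

text \<open>An orthogonal matrix that carries a coordinate axis to the radial direction diagonalizes the
  metric, with one eigenvalue \<open>1\<close> and all others \<open>(\<psi>(r) / r)\<^sup>2\<close>.\<close>

lemma det_model_metric:
  fixes x :: "real^'n"
  assumes "x \<noteq> 0"
  shows "det (model_metric \<psi> x) = ((\<psi> (norm x) / norm x)\<^sup>2) ^ (CARD('n) - 1)"
proof -
  define q where "q = (\<psi> (norm x) / norm x)\<^sup>2"
  have "norm (sgn x) = 1" using assms by (simp add: norm_sgn)
  then obtain k :: 'n and Q where Q: "orthogonal_matrix Q" "Q *v axis k 1 = sgn x"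
    using orthogonal_matrix_exists_basis by metis
  define D :: "real^'n^'n" where "D = (\<chi> i j. if i = j then if i = k then 1 else q else 0)"
  have "model_metric \<psi> x ** Q = Q ** D"
  proof -
    have "model_metric \<psi> x *v (Q *v axis j 1) = Q *v (D *v axis j 1)" for j
    proof -
      have "sgn x \<bullet> (Q *v axis j 1) = axis k 1 \<bullet> (axis j 1 :: real^'n)"
        using Q orthogonal_transformation_matrix[of "(*v) Q"]
        by (metis matrix_of_matrix_vector_mul matrix_vector_mul_linear orthogonal_transformation_def)
      also have "\<dots> = (if j = k then 1 else 0)"
        by (simp add: inner_axis_axis)
      finally have inner: "sgn x \<bullet> (Q *v axis j 1) = (if j = k then 1 else 0)" .
      have D: "D *v axis j 1 = (if j = k then 1 else q) *\<^sub>R axis j 1"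
        unfolding matrix_vector_mult_basis by (simp add: vec_eq_iff column_def D_def axis_def)
      show ?thesis
        using Q(2) by (simp add: model_metric_mult[OF assms] inner D q_def matrix_vector_mult_scaleR)
    qed
    then have "column j (model_metric \<psi> x ** Q) = column j (Q ** D)" for j
      by (metis matrix_vector_mul_assoc matrix_vector_mult_basis)
    then show ?thesis
      by (simp add: vec_eq_iff column_def)
  qed
  then have "det (model_metric \<psi> x) * det Q = det Q * det D"
    by (metis det_mul)
  moreover have "det Q \<noteq> 0"
    using det_orthogonal_matrix[OF Q(1)] by auto
  moreover have "det D = (\<Prod>i\<in>UNIV. if i = k then 1 else q)"
    by (subst det_diagonal) (auto simp: D_def)
  moreover have "\<dots> = q ^ (CARD('n) - 1)"
    by (subst prod.remove[of _ k]) (auto simp: card_Diff_singleton intro!: prod.cong)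
  ultimately show ?thesis by (simp add: q_def)
qed

text \<open>Away from the pole the radial direction is an eigenvector of the metric for the eigenvalue
  \<open>1\<close>, so the gradient of \<open>u\<close> is \<open>f' x / \<bar>x\<bar>\<close>. Multiplied by the density
  \<open>(\<psi> / r) ^ (n - 1)\<close> it becomes \<open>h(\<bar>x\<bar>) x\<close> with \<open>h(r) = \<psi> ^ (n - 1) f' / r ^ n\<close>, and the
  divergence of this field is the derivative of the flux divided by \<open>r ^ (n - 1)\<close>.\<close>

lemma laplace_beltrami_radial:
  fixes u :: "real^'n \<Rightarrow> real"
  assumes u: "\<And>y. y \<in> ball 0 R \<Longrightarrow> u y = f (norm y)"
    and f: "\<And>s. 0 < s \<Longrightarrow> s < R \<Longrightarrow> (f has_real_derivative f' s) (at s)"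
    and \<psi>_pos: "\<And>s. 0 < s \<Longrightarrow> s < R \<Longrightarrow> 0 < \<psi> s"
    and x: "x \<in> ball 0 R" "x \<noteq> 0"
    and flux: "((\<lambda>s. \<psi> s ^ (CARD('n) - 1) * f' s) has_real_derivative z') (at (norm x))"
  shows "laplace_beltrami (model_metric \<psi>) u x = z' / \<psi> (norm x) ^ (CARD('n) - 1)"
proof -
  define n where "n = CARD('n)"
  have n: "0 < n" by (simp add: n_def)
  define S :: "(real^'n) set" where "S = ball 0 R - {0}"
  have S: "open S" "x \<in> S" using x by (auto simp: S_def)
  have sqrt_det: "sqrt (det (model_metric \<psi> y)) = (\<psi> (norm y) / norm y) ^ (n - 1)"
    if "y \<in> S" for y
  proof -
    have y: "y \<noteq> 0" "0 < \<psi> (norm y)" using that \<psi>_pos by (auto simp: S_def)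
    have "det (model_metric \<psi> y) = ((\<psi> (norm y) / norm y) ^ (n - 1))\<^sup>2"
      unfolding det_model_metric[OF y(1)] n_def by (simp only: power_mult[symmetric] mult.commute)
    with y show ?thesis by simp
  qed
  have grad: "riem_grad (model_metric \<psi>) u y = f' (norm y) *\<^sub>R sgn y" if "y \<in> S" for y
  proof -
    have y: "y \<noteq> 0" "y \<in> ball 0 R" "0 < norm y" "norm y < R" using that by (auto simp: S_def)
    have "(u has_derivative (\<lambda>v. f' (norm y) * (v \<bullet> sgn y))) (at y)"
      by (rule has_derivative_transform_within_open[OF radial_has_derivative[OF y(1) f],
            where s = "ball 0 R"]) (use y u in auto)
    then have "(\<chi> i. partial_deriv i u y) = f' (norm y) *\<^sub>R sgn y"
      by (simp add: vec_eq_iff partial_deriv_has_derivative inner_axis')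
    moreover have "model_metric \<psi> y *v (f' (norm y) *\<^sub>R sgn y) = f' (norm y) *\<^sub>R sgn y"
      using y by (simp add: model_metric_mult dot_square_norm norm_sgn)
    moreover have "invertible (model_metric \<psi> y)"
      unfolding invertible_det_nz det_model_metric[OF y(1)] using \<psi>_pos[OF y(3,4)] y by simp
    then have "matrix_inv (model_metric \<psi> y) ** model_metric \<psi> y = mat 1"
      unfolding invertible_def matrix_inv_def by (rule someI2_ex) simp
    ultimately show ?thesis
      unfolding riem_grad_def by (metis matrix_vector_mul_assoc matrix_vector_mul_lid)
  qed
  define h where "h s = \<psi> s ^ (n - 1) * f' s / s ^ n" for s
  have field: "sqrt (det (model_metric \<psi> y)) * riem_grad (model_metric \<psi>) u y $ i = h (norm y) * y $ i"
    if "y \<in> S" for y i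
  proof -
    have "norm y ^ n = norm y ^ (n - 1) * norm y"
      using n by (simp add: power_eq_if)
    then show ?thesis
      using that by (simp add: sqrt_det grad h_def sgn_div_norm power_divide S_def field_simps)
  qed
  define r where "r = norm x"
  have r: "0 < r" "r < R" using x by (auto simp: r_def)
  define W where "W = \<psi> r ^ (n - 1)"
  have W: "W \<noteq> 0" using \<psi>_pos[OF r] by (simp add: W_def)
  define h' where "h' = (z' * r ^ n - W * f' r * (n * r ^ (n - 1))) / (r ^ n * r ^ n)"
  have "(h has_real_derivative h') (at r)"
    using DERIV_divide[OF flux[folded n_def r_def] DERIV_pow[of n r]] r
    unfolding h_def h'_def W_def by simp
  then have "(\<Sum>i\<in>UNIV. partial_deriv i (\<lambda>y. h (norm y) * y $ i) x) = h' * r + real n * h r"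
    unfolding r_def n_def by (rule partial_deriv_radial_field[OF x(2)])
  also have "\<dots> = z' / r ^ (n - 1)"
  proof -
    have "r ^ n = r ^ (n - 1) * r"
      using n by (simp add: power_eq_if)
    then show ?thesis
      using r unfolding h'_def h_def W_def by (simp add: field_simps)
  qed
  finally have "(\<Sum>i\<in>UNIV. partial_deriv i
      (\<lambda>y. sqrt (det (model_metric \<psi> y)) * riem_grad (model_metric \<psi>) u y $ i) x) = z' / r ^ (n - 1)"
    using partial_deriv_cong[OF S field] by simp
  then show ?thesis
    unfolding laplace_beltrami_def riem_div_def sqrt_det[OF S(2)]
    using r W by (simp add: power_divide r_def[symmetric] n_def[symmetric] W_def)
qed

section \<open>Absence of sign changes and of radial Dirichlet solutions\<close>

text \<open>The profile is the restriction of \<open>u\<close> to a coordinate axis, so that its first two derivatives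
  are iterated partial derivatives of \<open>u\<close>. The profile extends to an even function, and therefore
  its derivative at the pole is \<open>0\<close>.\<close>

lemma dirichlet_radial_profile:
  fixes u :: "real^'n \<Rightarrow> real"
  assumes R: "0 < R" and p: "1 < p"
    and \<psi>_cont: "continuous_on {0..R} \<psi>"
    and \<psi>_deriv: "\<And>r. 0 < r \<Longrightarrow> r < R \<Longrightarrow> (\<psi> has_real_derivative \<psi>' r) (at r)"
    and \<psi>_pos: "\<And>r. 0 < r \<Longrightarrow> r < R \<Longrightarrow> 0 < \<psi> r"
    and sol: "dirichlet_solution \<psi> p R u" and radial: "radial_on (cball 0 R) u"
  obtains f f' where "\<And>x. x \<in> cball 0 R \<Longrightarrow> u x = f (norm x)"
    and "radial_lane_emden R p (\<lambda>r. \<psi> r ^ (CARD('n) - 1))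
      (\<lambda>r. real (CARD('n) - 1) * (\<psi>' r * \<psi> r ^ (CARD('n) - 1 - Suc 0))) f f'"
proof -
  obtain k :: 'n where True by simp
  define e :: "real^'n" where "e = axis k 1"
  have e: "norm e = 1" "e \<noteq> 0" by (simp_all add: e_def)
  define f where "f s = u (s *\<^sub>R e)" for s
  define f' where "f' s = partial_deriv k u (s *\<^sub>R e)" for s
  obtain F where F: "\<And>x. x \<in> cball 0 R \<Longrightarrow> u x = F (norm x)"
    using radial by (auto simp: radial_on_def)
  have u_f: "u x = f (norm x)" if "x \<in> cball 0 R" for x
    using that F[of x] F[of "norm x *\<^sub>R e"] by (simp add: f_def e)
  have along: "\<exists>D. ((\<lambda>t. g (t *\<^sub>R e)) has_real_derivative D) (at s) \<and> D = partial_deriv k g (s *\<^sub>R e)"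
    if C1: "C1_on (ball 0 R) g" and s: "\<bar>s\<bar> < R" for g :: "real^'n \<Rightarrow> real" and s
  proof -
    have "s *\<^sub>R e \<in> ball 0 R" using s by (simp add: e)
    then obtain D where D: "(g has_derivative D) (at (s *\<^sub>R e))"
      using C1 unfolding C1_on_def differentiable_def by blast
    show ?thesis
      using has_derivative_along_axis[of g D 0 s k] D partial_deriv_has_derivative[OF D, of k]
      by (auto simp: e_def)
  qed
  have C2: "C1_on (ball 0 R) u" "C1_on (ball 0 R) (partial_deriv k u)"
    using sol by (auto simp: dirichlet_solution_def C2_on_def)
  have f_deriv: "(f has_real_derivative f' s) (at s)" if "\<bar>s\<bar> < R" for s
    using along[OF C2(1) that] by (simp add: f_def[abs_def] f'_def)
  define f'' where "f'' s = partial_deriv k (partial_deriv k u) (s *\<^sub>R e)" for s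
  have f'_deriv: "(f' has_real_derivative f'' s) (at s)" if "\<bar>s\<bar> < R" for s
    using along[OF C2(2) that] by (simp add: f'_def[abs_def] f''_def)
  have "f' 0 = 0"
  proof -
    have "((\<lambda>s. f (- s)) has_real_derivative - f' 0) (at 0)"
      using DERIV_mirror[of f "f' 0" 0] f_deriv[of 0] R by simp
    then have "(f has_real_derivative - f' 0) (at 0)"
    proof (rule has_field_derivative_transform_within_open[where S = "{-R<..<R}"])
      show "f (- s) = f s" if "s \<in> {-R<..<R}" for s
      proof -
        have s: "\<bar>s\<bar> \<le> R" using that by auto
        then show ?thesis
          using F[of "s *\<^sub>R e"] F[of "(- s) *\<^sub>R e"] by (simp add: f_def e)
      qed
    qed (use R in auto)
    with f_deriv[of 0] R have "f' 0 = - f' 0" by (intro DERIV_unique) auto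
    then show ?thesis by simp
  qed
  define m where "m = CARD('n) - 1"
  have w_deriv: "((\<lambda>s. \<psi> s ^ m) has_real_derivative real m * (\<psi>' r * \<psi> r ^ (m - Suc 0))) (at r)"
    if "0 < r" "r < R" for r
    using DERIV_power[OF \<psi>_deriv[OF that]] by simp
  have "radial_lane_emden R p (\<lambda>r. \<psi> r ^ m) (\<lambda>r. real m * (\<psi>' r * \<psi> r ^ (m - Suc 0))) f f'"
  proof
    show "continuous_on {0..R} (\<lambda>r. \<psi> r ^ m)"
      by (intro continuous_intros \<psi>_cont)
    have "continuous_on (cball 0 R) u" using sol by (simp add: dirichlet_solution_def)
    then show "continuous_on {0..R} f"
      unfolding f_def by (rule continuous_on_compose2) (auto intro!: continuous_intros simp: e)
    show "(f has_real_derivative 0) (at_right 0)"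
      using f_deriv[of 0] R \<open>f' 0 = 0\<close> by (auto intro: has_field_derivative_at_within)
    fix r assume r: "0 < r" "r < R"
    define x where "x = r *\<^sub>R e"
    have x: "x \<in> ball 0 R" "x \<noteq> 0" "norm x = r" using r by (auto simp: x_def e)
    define z' where "z' = real m * (\<psi>' r * \<psi> r ^ (m - Suc 0)) * f' r + f'' r * \<psi> r ^ m"
    have flux: "((\<lambda>s. \<psi> s ^ m * f' s) has_real_derivative z') (at r)"
      unfolding z'_def using r by (intro DERIV_mult w_deriv f'_deriv) auto
    have "laplace_beltrami (model_metric \<psi>) u x = z' / \<psi> (norm x) ^ (CARD('n) - 1)"
      by (rule laplace_beltrami_radial[OF _ _ \<psi>_pos x(1,2)])
        (use u_f f_deriv flux in \<open>auto simp: x(3) m_def\<close>)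
    moreover have "- laplace_beltrami (model_metric \<psi>) u x = \<bar>u x\<bar> powr (p - 1) * u x"
      using sol x(1) by (simp add: dirichlet_solution_def)
    moreover have "u x = f r" using u_f[of x] x by simp
    ultimately have "- (z' / \<psi> r ^ m) = \<bar>f r\<bar> powr (p - 1) * f r"
      unfolding m_def x(3) by metis
    moreover have "\<psi> r ^ m * (- (z' / \<psi> r ^ m)) = - z'"
      using \<psi>_pos[OF r] by simp
    ultimately have "z' = - (\<psi> r ^ m * (\<bar>f r\<bar> powr (p - 1) * f r))"
      by (metis minus_minus)
    with flux show "((\<lambda>s. \<psi> s ^ m * f' s) has_real_derivative
        - (\<psi> r ^ m * (\<bar>f r\<bar> powr (p - 1) * f r))) (at r)"
      by simp
  qed (use R p \<psi>_pos w_deriv f_deriv in auto)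
  then show thesis
    using that u_f by (simp add: m_def)
qed

theorem theorem2p7:
  fixes n :: nat and p :: real and \<psi> \<psi>' \<psi>'' :: "real \<Rightarrow> real"
  assumes dim: "n = CARD('n::finite)" "n \<ge> 3"
    and p: "p \<ge> (real n + 2) / (real n - 2)"
    and \<psi>': "\<And>r. r \<ge> 0 \<Longrightarrow> (\<psi> has_real_derivative \<psi>' r) (at r within {0..})"
    and \<psi>'': "\<And>r. r \<ge> 0 \<Longrightarrow> (\<psi>' has_real_derivative \<psi>'' r) (at r within {0..})"
    and \<psi>''_cont: "continuous_on {0..} \<psi>''"
    and \<psi>_pos: "\<And>r. r > 0 \<Longrightarrow> \<psi> r > 0"
    and \<psi>_0: "\<psi> 0 = 0" "\<psi>'' 0 = 0" "\<psi>' 0 = 1"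
    and \<psi>'_nonneg: "\<And>r. r > 0 \<Longrightarrow> \<psi>' r \<ge> 0"
    and critical: "p = (real n + 2) / (real n - 2) \<Longrightarrow>
      \<exists>\<delta>>0. \<exists>\<psi>''' :: real \<Rightarrow> real.
        (\<forall>r\<in>{0..<\<delta>}. (\<psi>'' has_real_derivative \<psi>''' r) (at r within {0..})) \<and>
        \<psi>'' 0 = 0 \<and> \<psi>''' 0 > 0"
    and A_convex: "convex_on {0..}
      (\<lambda>r. (integral {0..r} (\<lambda>s. \<psi> s ^ (n - 1))) powr ((p - 1) / (2 * (p + 1))))"
  shows "(\<forall>\<alpha> u. \<alpha> \<noteq> 0 \<longrightarrow> ivp_solution n \<psi> p \<alpha> u \<longrightarrow> \<not> changes_sign_on {0..} u) \<and>
    (\<forall>R>0. \<not> (\<exists>u :: real^'n \<Rightarrow> real. dirichlet_solution \<psi> p R u \<and>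
      radial_on (cball 0 R) u \<and> (\<exists>x\<in>cball 0 R. u x \<noteq> 0)))"
proof -
  have "1 < (real n + 2) / (real n - 2)" using dim(2) by (simp add: field_simps)
  with p have p_gt_1: "1 < p" by linarith
  define w where "w r = \<psi> r ^ (n - 1)" for r
  define w' where "w' r = real (n - 1) * (\<psi>' r * \<psi> r ^ (n - 1 - Suc 0))" for r
  define V where "V r = integral {0..r} w" for r
  have \<psi>_cont: "continuous_on {0..} \<psi>"
    using \<psi>' by (intro DERIV_continuous_on) auto
  have \<psi>_deriv: "(\<psi> has_real_derivative \<psi>' r) (at r)" if "0 < r" for r
    using \<psi>'[of r] that at_within_interior[of r "{0..}"] by simp
  have w_deriv: "(w has_real_derivative w' r) (at r)" if "0 < r" for r
    unfolding w_def w'_def using DERIV_power[OF \<psi>_deriv[OF that], of "n - 1"] by simp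
  have w_pos: "0 < w r" if "0 < r" for r
    using \<psi>_pos[OF that] by (simp add: w_def)
  have w_cont: "continuous_on {0..r} w" for r
    unfolding w_def by (intro continuous_intros continuous_on_subset[OF \<psi>_cont]) auto
  have V_deriv: "(V has_real_derivative w r) (at r)" if "0 < r" for r
    using integral_has_real_derivative[OF w_cont, of r "r + 1"] that
      at_within_Icc_at[of 0 r "r + 1"] by (simp add: V_def[abs_def])
  have V_cont: "continuous_on {0..r} V" for r
    unfolding V_def[abs_def]
    by (intro indefinite_integral_continuous_1 integrable_continuous_real w_cont)
  have V_0: "V 0 = 0" by (simp add: V_def)
  then have V_lim: "(V \<longlongrightarrow> 0) (at_right 0)"
    using continuous_on_Icc_at_rightD[OF V_cont, of 1] by simp
  have V_pos: "0 < V r" if "0 < r" for r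
    using DERIV_pos_imp_increasing_open[OF that _ V_cont] V_deriv w_pos V_0 by force
  have growth: "(p + 3) / (2 * (p + 1)) * (w r)\<^sup>2 \<le> V r * w' r" if "0 < r" for r
  proof -
    have "convex_on {0<..} (\<lambda>r. V r powr ((p - 1) / (2 * (p + 1))))"
      using convex_on_subset[OF A_convex, of "{0<..}"] by (simp add: V_def w_def[abs_def] subset_eq)
    from convex_powr_imp_growth[OF this _ V_deriv V_pos w_deriv that]
    show ?thesis using p_gt_1 by (simp add: field_simps)
  qed
  have no_zero: "u R \<noteq> 0" if "radial_lane_emden R p w w' u u'" "u 0 \<noteq> 0" for R u u'
    by (rule radial_lane_emden.no_zero[OF that(1) V_deriv V_lim V_pos growth that(2)])

  have "\<not> changes_sign_on {0..} u" if "\<alpha> \<noteq> 0" and ivp: "ivp_solution n \<psi> p \<alpha> u" for \<alpha> u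
  proof
    from ivp obtain u' z' where
      u': "\<And>r. 0 \<le> r \<Longrightarrow> (u has_real_derivative u' r) (at r within {0..})" and
      z': "\<And>r. 0 < r \<Longrightarrow> ((\<lambda>s. w s * u' s) has_real_derivative z' r) (at r)" and
      eq: "\<And>r. 0 < r \<Longrightarrow> - (1 / w r) * z' r = \<bar>u r\<bar> powr (p - 1) * u r" and
      initial: "u 0 = \<alpha>" "u' 0 = 0"
      unfolding ivp_solution_def w_def by blast
    have u_cont: "continuous_on {0..} u"
      using u' by (intro DERIV_continuous_on) auto
    have lane_emden: "radial_lane_emden R p w w' u u'" if "0 < R" for R
    proof
      show "continuous_on {0..R} u"
        by (rule continuous_on_subset[OF u_cont]) auto
      show "(u has_real_derivative 0) (at_right 0)"
        using u'[of 0] initial by (auto intro: DERIV_subset)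
      fix r :: real assume r: "0 < r"
      show "(u has_real_derivative u' r) (at r)"
        using u'[of r] r at_within_interior[of r "{0..}"] by simp
      have "z' r = - (w r * (\<bar>u r\<bar> powr (p - 1) * u r))"
        using eq[OF r] w_pos[OF r] by (simp add: field_simps)
      with z'[OF r] show "((\<lambda>s. w s * u' s) has_real_derivative
          - (w r * (\<bar>u r\<bar> powr (p - 1) * u r))) (at r)"
        by simp
    qed (use that p_gt_1 w_cont w_pos w_deriv in auto)
    assume "changes_sign_on {0..} u"
    then obtain r s where rs: "0 \<le> r" "0 \<le> s" "u r < 0" "0 < u s"
      by (auto simp: changes_sign_on_def)
    have "\<exists>x\<ge>0. u x = 0"
    proof (cases "r \<le> s")
      case True
      then have "\<exists>x\<ge>r. x \<le> s \<and> u x = 0"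
        using rs by (intro IVT') (auto intro: continuous_on_subset[OF u_cont])
      with rs show ?thesis by (meson order_trans)
    next
      case False
      then have "\<exists>x\<ge>s. x \<le> r \<and> u x = 0"
        using rs by (intro IVT2') (auto intro: continuous_on_subset[OF u_cont])
      with rs show ?thesis by (meson order_trans)
    qed
    then obtain x where x: "0 \<le> x" "u x = 0" by blast
    with initial \<open>\<alpha> \<noteq> 0\<close> have "0 < x" by (cases "x = 0") auto
    \<comment> \<open>the solution is nonzero at the pole, so a zero would be at a positive radius\<close>
    from no_zero[OF lane_emden[OF this]] initial \<open>\<alpha> \<noteq> 0\<close> x show False by simp
  qed
  moreover have "u x = 0"
    if R: "0 < R" and sol: "dirichlet_solution \<psi> p R u" and radial: "radial_on (cball 0 R) u"
      and x: "x \<in> cball 0 R" for R and u :: "real^'n \<Rightarrow> real" and x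
  proof -
    obtain f f' where u_f: "\<And>y. y \<in> cball 0 R \<Longrightarrow> u y = f (norm y)"
      and "radial_lane_emden R p (\<lambda>r. \<psi> r ^ (CARD('n) - 1))
        (\<lambda>r. real (CARD('n) - 1) * (\<psi>' r * \<psi> r ^ (CARD('n) - 1 - Suc 0))) f f'"
      using dirichlet_radial_profile[OF R p_gt_1 continuous_on_subset[OF \<psi>_cont] \<psi>_deriv \<psi>_pos
          sol radial] by auto
    then interpret profile: radial_lane_emden R p w w' f f'
      by (simp add: w_def[abs_def] w'_def[abs_def] dim(1))
    have boundary: "f R = 0"
      using sol R u_f[of "R *\<^sub>R axis (SOME k. True) 1"] by (simp add: dirichlet_solution_def)
    then have "f 0 = 0"
      using no_zero[OF profile.radial_lane_emden_axioms] by blast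
    show ?thesis
    proof (cases "norm x = R")
      case False
      with x have "norm x < R" by simp
      moreover have "0 \<le> w' r" if "0 < r" for r
        using \<psi>_pos[OF that] \<psi>'_nonneg[OF that] by (simp add: w'_def)
      ultimately have "f (norm x) = 0"
        using profile.trivial_if_zero_at_pole \<open>f 0 = 0\<close> norm_ge_zero by blast
      with u_f[OF x] show ?thesis by simp
    qed (use u_f[OF x] boundary in simp)
  qed
  ultimately show ?thesis by blast
qed

end
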